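(* Let $c>0$ and let $(\beta_n)$ be a sequence in $[0,1)$ with $\beta_n\to0$ as $n\to\infty$. Then for each $f\in C_{\rho_0}(\mathbb{R}^+)$ and each $\lambda>0$, $$\lim_{n\to\infty}\sup_{x\in[0,\infty)}\frac{|\mathcal{D}_{n,c}^{\beta_n}(f,x)-f(x)|}{(1+x^2)^{1+\lambda}}=0.$$
   Context: For $\beta\in[0,1)$, $x\ge 0$, $n\in\mathbb{N}$ and integers $v\ge0$ let $\omega_\beta(v,nx)=nx(nx+v\beta)^{v-1}\frac{e^{-(nx+v\beta)}}{v!}$. For $c>0$, integers $v\ge1$ and $t\ge0$ let $p_{n,v-1,c}(t)=c\,\frac{\Gamma(n/c+v-1)}{\Gamma(v)\Gamma(n/c)}\cdot\frac{(ct)^{v-1}}{(1+ct)^{n/c+v-1}}$. The modified Jain-Baskakov operators (for $n>3c$) are $$\mathcal{D}_{n,c}^{\beta}(f,x)=\frac{n-c}{c}\sum_{v=1}^{\infty}\omega_\beta(v,nx)\int_0^\infty p_{n,v-1,c}(t)f(t)\,dt+e^{-nx}f(0).$$ With $\rho_0(x)=1+x^2$, $C_{\rho_0}(\mathbb{R}^+)$ is the set of continuous functions $f$ on $[0,\infty)$ such that $|f(x)|\le M_f(1+x^2)$ for some constant $M_f$ and $f(x)/\rho_0(x)$ converges as $x\to\infty$. *)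

theory Defs
  imports "HOL-Analysis.Analysis"
begin

definition omega_beta :: "real \<Rightarrow> nat \<Rightarrow> real \<Rightarrow> real" where
  "omega_beta \<beta> v y = y * (y + real v * \<beta>) ^ (v - 1) * exp (- (y + real v * \<beta>)) / fact v"

text \<open>p_{n,v-1,c}(t) for v >= 1\<close>
definition p_JB :: "nat \<Rightarrow> nat \<Rightarrow> real \<Rightarrow> real \<Rightarrow> real" where
  "p_JB n v c t = c * Gamma (real n / c + real v - 1) / (Gamma (real v) * Gamma (real n / c))
     * (c * t) ^ (v - 1) / (1 + c * t) powr (real n / c + real v - 1)"

definition D_op :: "nat \<Rightarrow> real \<Rightarrow> real \<Rightarrow> (real \<Rightarrow> real) \<Rightarrow> real \<Rightarrow> real" where
  "D_op n c \<beta> f x =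
     (real n - c) / c *
       (\<Sum>k. omega_beta \<beta> (Suc k) (real n * x) *
              (LINT t:{0..}|lborel. p_JB n (Suc k) c t * f t))
     + exp (- (real n * x)) * f 0"

definition C_rho0 :: "(real \<Rightarrow> real) set" where
  "C_rho0 = {f. continuous_on {0..} f \<and> (\<exists>M. \<forall>x\<ge>0. \<bar>f x\<bar> \<le> M * (1 + x\<^sup>2))
              \<and> (\<exists>L. ((\<lambda>x. f x / (1 + x\<^sup>2)) \<longlongrightarrow> L) at_top)}"

end

theory Submission
  imports Defs
begin

text \<open>
  On \<open>[0, A]\<close> a Korovkin argument applies: \<open>\<bar>f t - f x\<bar> \<le> \<epsilon> + K (t - x)\<^sup>2\<close>, and the
  operator applied to the right-hand side is computed from the moments of order at most two. For
  \<open>x > A\<close> the growth bound \<open>f = O(1 + x\<^sup>2)\<close> is beaten by the extra factor \<open>(1 + x\<^sup>2) powr lam\<close>.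

  Because \<open>\<beta> n\<close> tends to 0, the moments of the Jain weights are needed only for small \<open>\<beta>\<close>,
  say \<open>\<beta> \<le> 1/16\<close>. There the double series obtained by expanding \<open>exp (- (a + k\<beta>))\<close> in
  \<open>\<Sum>k. (a + k\<beta>)\<^bsup>k+p\<^esup> exp (- (a + k\<beta>)) / k!\<close> converges absolutely, and summing it along the
  diagonals turns the coefficients into \<open>N\<close>-th differences of \<open>(a + k\<beta>)\<^bsup>N+p\<^esup>\<close>, so that
  Lagrange inversion is not needed.
\<close>

subsection \<open>Forward differences and Abel-type series\<close>

text \<open>One factor \<open>a + k b\<close> is split off. The part \<open>a\<close> comes out of
  the sum; in the part \<open>k b\<close>, the absorption identity turns
  \<open>k (N choose k)\<close> into \<open>N (N-1 choose k-1)\<close>, and shifting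
  \<open>k\<close> moves the base point to \<open>a + b\<close>. For \<open>N = 0\<close> the
  truncated \<open>N - 1\<close> is harmless because of the factor \<open>real N\<close>.\<close>

lemma sum_fwd_diff_Suc:
  fixes a b :: real
  shows "(\<Sum>k\<le>N. (-1)^(N-k) * real (N choose k) * (a + real k * b)^Suc m)
    = a * (\<Sum>k\<le>N. (-1)^(N-k) * real (N choose k) * (a + real k * b)^m)
      + b * real N * (\<Sum>k\<le>N-1. (-1)^(N-1-k) * real ((N-1) choose k) * (a + b + real k * b)^m)"
proof (cases N)
  case 0
  then show ?thesis by simp
next
  case (Suc M)
  have "(\<Sum>k\<le>N. (-1)^(N-k) * real (N choose k) * (a + real k * b)^Suc m)
    = a * (\<Sum>k\<le>N. (-1)^(N-k) * real (N choose k) * (a + real k * b)^m)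
      + b * (\<Sum>k\<le>Suc M. (-1)^(Suc M-k) * (real k * real (Suc M choose k)) * (a + real k * b)^m)"
    by (simp add: Suc sum_distrib_left sum.distrib [symmetric] algebra_simps del: sum.atMost_Suc binomial_Suc_Suc)
  also have "(\<Sum>k\<le>Suc M. (-1)^(Suc M-k) * (real k * real (Suc M choose k)) * (a + real k * b)^m)
    = (\<Sum>k\<le>M. (-1)^(M-k) * (real (Suc k) * real (Suc M choose Suc k)) * (a + real (Suc k) * b)^m)"
    by (subst sum.atMost_Suc_shift) simp
  also have "\<dots> = (\<Sum>k\<le>M. real N * ((-1)^(M-k) * real (M choose k) * (a + b + real k * b)^m))"
  proof (rule sum.cong [OF refl])
    fix k assume "k \<in> {..M}"
    have "real (Suc k) * real (Suc M choose Suc k) = real N * real (M choose k)"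
      unfolding Suc of_nat_mult [symmetric] by (simp only: Suc_times_binomial)
    moreover have "a + real (Suc k) * b = a + b + real k * b" by (simp add: algebra_simps)
    ultimately have "(-1)^(M-k) * (real (Suc k) * real (Suc M choose Suc k)) * (a + real (Suc k) * b)^m
      = (-1)^(M-k) * (real N * real (M choose k)) * (a + b + real k * b)^m" by (simp only:)
    then show "(-1)^(M-k) * (real (Suc k) * real (Suc M choose Suc k)) * (a + real (Suc k) * b)^m
      = real N * ((-1)^(M-k) * real (M choose k) * (a + b + real k * b)^m)" by (simp only: mult_ac)
  qed
  finally show ?thesis by (simp add: Suc sum_distrib_left mult.assoc)
qed

text \<open>Each use of the recursion lowers \<open>m\<close> by one and \<open>N\<close> by at most
  one, so \<open>m < N\<close> survives until \<open>m = 0\<close>, where the sum is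
  \<open>(1 - 1)^N\<close> with \<open>N > 0\<close>.\<close>

lemma fwd_diff_power_less:
  fixes a b :: real
  assumes "m < N"
  shows "(\<Sum>k\<le>N. (-1)^(N-k) * real (N choose k) * (a + real k * b)^m) = 0"
  using assms
proof (induction m arbitrary: N a)
  case 0
  have "(\<Sum>k\<le>N. real (N choose k) * 1^k * (-1)^(N-k)) = (1 + (-1))^N"
    by (rule binomial_ring [symmetric])
  with 0 show ?case by (simp add: mult.commute)
next
  case (Suc m)
  then show ?case
    using Suc.IH [of "N - 1" "a + b"] Suc.IH [of N a] by (subst sum_fwd_diff_Suc) (simp del: diff_diff_left)
qed

lemma fwd_diff_power_eq:
  fixes a b :: real
  shows "(\<Sum>k\<le>N. (-1)^(N-k) * real (N choose k) * (a + real k * b)^N) = fact N * b^N"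
proof (induction N arbitrary: a)
  case (Suc N)
  have "(\<Sum>k\<le>Suc N. (-1)^(Suc N-k) * real (Suc N choose k) * (a + real k * b)^Suc N)
     = a * 0 + b * real (Suc N) * (fact N * b^N)"
    by (subst sum_fwd_diff_Suc, subst fwd_diff_power_less) (simp_all only: diff_Suc_1 Suc.IH lessI)
  then show ?case by simp
qed simp

text \<open>One degree above the order of the difference both terms of the recursion survive: the
  first is \<open>fwd_diff_power_eq\<close>, the second the induction hypothesis at
  \<open>a + b\<close>.\<close>

lemma fwd_diff_power_Suc:
  fixes a b :: real
  shows "(\<Sum>k\<le>N. (-1)^(N-k) * real (N choose k) * (a + real k * b)^Suc N)
    = fact (Suc N) * b^N * (a + real N * b / 2)"
proof (induction N arbitrary: a)
  case (Suc N)
  have "(\<Sum>k\<le>Suc N. (-1)^(Suc N-k) * real (Suc N choose k) * (a + real k * b)^Suc (Suc N))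
     = a * (fact (Suc N) * b^Suc N) + b * real (Suc N) * (fact (Suc N) * b^N * (a + b + real N * b / 2))"
    by (subst sum_fwd_diff_Suc, subst fwd_diff_power_eq) (simp_all only: diff_Suc_1 Suc.IH)
  also have "\<dots> = fact (Suc (Suc N)) * b^Suc N * (a + real (Suc N) * b / 2)"
    by (simp add: field_simps)
  finally show ?case .
qed simp

text \<open>Fubini for a double series whose absolute row sums \<open>B\<close> are summable: both
  orders of summation give the unordered sum over all pairs.\<close>

lemma sums_diagonal:
  fixes g :: "nat \<Rightarrow> nat \<Rightarrow> real"
  assumes g: "\<And>k. (\<lambda>j. \<bar>g k j\<bar>) sums B k" and B: "summable B"
  shows "(\<lambda>k. \<Sum>j. g k j) sums (\<Sum>N. \<Sum>k\<le>N. g k (N - k))"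
proof -
  have gk: "(\<lambda>j. norm (g k j)) summable_on UNIV" for k
    using g [of k] by (simp add: summable_on_UNIV_nonneg_real_iff sums_iff)
  have infB: "(\<Sum>\<^sub>\<infinity>j. \<bar>g k j\<bar>) = B k" for k
    using g [of k] by (intro infsumI norm_summable_imp_has_sum) (auto simp: sums_iff)
  have B0: "B k \<ge> 0" for k using infB [of k] by (metis abs_ge_zero infsum_nonneg)
  have "(\<lambda>z. norm (case z of (k,j) \<Rightarrow> g k j)) summable_on (SIGMA k:UNIV. UNIV)"
    unfolding Infinite_Sum.abs_summable_on_Sigma_iff using gk B B0
    by (simp add: infB summable_on_UNIV_nonneg_real_iff)
  then have sm: "(\<lambda>(k,j). g k j) summable_on (SIGMA k:UNIV. UNIV)"
    by (rule Infinite_Sum.abs_summable_summable)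
  define S where "S = infsum (\<lambda>(k,j). g k j) (SIGMA k:UNIV. UNIV)"
  have hs: "((\<lambda>(k,j). g k j) has_sum S) (SIGMA k:UNIV. UNIV)"
    unfolding S_def using sm by (rule has_sum_infsum)
  have "((\<lambda>k. \<Sum>j. g k j) has_sum S) UNIV"
  proof (rule has_sum_SigmaD [OF hs])
    fix k show "((\<lambda>j. case (k, j) of (k, j) \<Rightarrow> g k j) has_sum (\<Sum>j. g k j)) UNIV"
      using gk [of k] g [of k] sums_summable [THEN summable_rabs_cancel, OF g [of k]]
      by (auto intro!: norm_summable_imp_has_sum simp: sums_iff)
  qed
  then have 1: "(\<lambda>k. \<Sum>j. g k j) sums S" by (rule has_sum_imp_sums)
  \<comment> \<open>The pair \<open>(k, j)\<close> is renamed \<open>(N, k)\<close> with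
    \<open>N = k + j\<close>, so that the fibre over \<open>N\<close> is a finite diagonal.\<close>
  have "((\<lambda>(N,k). g k (N-k)) has_sum S) (SIGMA N:UNIV. {..N})"
    using hs
    by (subst (asm) has_sum_reindex_bij_witness
        [where i = "\<lambda>(N,k). (k, N-k)" and j = "\<lambda>(k,j). (k+j, k)" and T = "SIGMA N:UNIV. {..N}"
           and h = "\<lambda>(N,k). g k (N-k)"]) auto
  then have "((\<lambda>N. \<Sum>k\<le>N. g k (N - k)) has_sum S) UNIV"
    by (rule has_sum_SigmaD) (auto intro: has_sum_finiteI)
  then have "(\<lambda>N. \<Sum>k\<le>N. g k (N - k)) sums S" by (rule has_sum_imp_sums)
  with 1 show ?thesis by (simp add: sums_iff)
qed

text \<open>The exponential has a plus sign because taking absolute values in the expansion of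
  \<open>exp (- z)\<close> gives \<open>exp z\<close>. The restriction \<open>b <= 1/16\<close>
  serves to make the majorant geometric with ratio below 1.\<close>

lemma abel_term_bound:
  fixes a b :: real
  assumes "a \<ge> 0" "0 \<le> b" "b \<le> 1/16" "p \<le> 1"
  shows "(a + real k * b)^(k+p) * exp (a + real k * b) / fact k \<le> exp (18 * a) * (9/16)^k"
proof -
  define z where "z = a + real k * b"
  have z: "0 \<le> z" "z \<le> a + real k / 16"
    using assms mult_left_mono [of b "1/16" "real k"] by (auto simp: z_def)
  \<comment> \<open>A single term of the exponential series is at most its sum; the scaling by 16
    yields the decay \<open>16^(-k)\<close>.\<close>
  have "(16 * z)^k / fact k \<le> exp (16 * z)"
  proof -
    have "(\<lambda>n. (16*z)^n /\<^sub>R fact n) sums exp (16 * z)" by (rule exp_converges)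
    then have s: "(\<lambda>n. (16*z)^n / fact n) sums exp (16 * z)" by (simp add: divide_inverse mult.commute scaleR_conv_of_real)
    have "sum (\<lambda>n. (16*z)^n / fact n) {k} \<le> (\<Sum>n. (16*z)^n / fact n)"
      using s z by (intro sum_le_suminf) (auto simp: sums_iff)
    with s show ?thesis by (simp add: sums_iff)
  qed
  then have 1: "z^k / fact k \<le> exp (16 * z) / 16^k" by (simp add: field_simps power_mult_distrib)
  have "z \<le> exp z" using exp_ge_add_one_self [of z] by linarith
  then have 2: "z^p \<le> exp z" using z \<open>p \<le> 1\<close> by (cases p) auto
  have "z^(k+p) * exp z / fact k = (z^k / fact k) * z^p * exp z" by (simp add: power_add)
  also have "\<dots> \<le> (exp (16 * z) / 16^k) * exp z * exp z"
    using 1 2 z by (intro mult_mono) auto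
  also have "\<dots> = exp (18 * z) / 16^k" by (simp add: exp_add [symmetric])
  \<comment> \<open>Here \<open>18 z <= 18 a + (18/16) k\<close>, and 18/16 is rounded up to 2; then
    \<open>exp 2 <= 9\<close> gives the ratio 9/16.\<close>
  also have "\<dots> \<le> exp (18 * a + real k * 2) / 16^k"
    using z by (intro divide_right_mono) auto
  also have "\<dots> = exp (18 * a) * (exp 2 / 16)^k"
    by (simp add: exp_add power_divide exp_of_nat_mult)
  also have "\<dots> \<le> exp (18 * a) * (9/16)^k"
  proof -
    have "exp (2::real) = exp 1 ^ 2" by (simp add: exp_of_nat_mult [symmetric])
    also have "\<dots> \<le> 3^2" using exp_le by (intro power_mono) auto
    finally show ?thesis by (intro mult_left_mono power_mono) auto
  qed
  finally show ?thesis by (simp add: z_def)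
qed

text \<open>After expanding \<open>exp (- z)\<close>, the terms with \<open>k + j = N\<close> all
  carry the same power \<open>z^(N+p)\<close>, up to sign, with coefficient
  \<open>1 / (k! (N-k)!)\<close>. Their sum is thus \<open>1/N!\<close> times an \<open>N\<close>-th
  difference, which is \<open>d N\<close>.\<close>

lemma abel_sums_fwd_diff:
  fixes a b :: real
  assumes "a \<ge> 0" "0 \<le> b" "b \<le> 1/16" "p \<le> 1"
    and d: "\<And>N. (\<Sum>k\<le>N. (-1)^(N-k) * real (N choose k) * (a + real k * b)^(N+p)) = fact N * d N"
    and "d sums S"
  shows "(\<lambda>k. (a + real k * b)^(k+p) * exp (- (a + real k * b)) / fact k) sums S"
proof -
  define z where "z k = a + real k * b" for k
  have z: "z k \<ge> 0" for k using assms by (simp add: z_def)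
  define g where "g k j = z k^(k+p) / fact k * ((- z k)^j / fact j)" for k j
  have e: "(\<lambda>j. y^j / fact j) sums exp y" for y :: real
    using exp_converges [of y] by (simp add: divide_inverse mult.commute)
  have "(\<lambda>j. \<bar>g k j\<bar>) sums (z k^(k+p) * exp (z k) / fact k)" for k
    using sums_mult [OF e, of "z k^(k+p) / fact k" "z k"] z [of k]
    by (simp add: g_def abs_mult power_abs)
  moreover have "summable (\<lambda>k. z k^(k+p) * exp (z k) / fact k)"
  proof (rule summable_comparison_test')
    show "summable (\<lambda>k. exp (18 * a) * (9/16::real)^k)" by (intro summable_mult summable_geometric) auto
    show "norm (z k^(k+p) * exp (z k) / fact k) \<le> exp (18 * a) * (9/16)^k" for k
      using abel_term_bound [OF assms(1-4), of k] z [of k] by (simp add: z_def)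
  qed
  ultimately have "(\<lambda>k. \<Sum>j. g k j) sums (\<Sum>N. \<Sum>k\<le>N. g k (N - k))"
    by (rule sums_diagonal)
  moreover have "(\<Sum>j. g k j) = z k^(k+p) * exp (- z k) / fact k" for k
    using sums_mult [OF e, of "z k^(k+p) / fact k" "- z k"] by (simp add: g_def sums_iff)
  moreover have "(\<Sum>k\<le>N. g k (N - k)) = d N" for N
  proof -
    have "fact N * (\<Sum>k\<le>N. g k (N - k)) = (\<Sum>k\<le>N. (-1)^(N-k) * real (N choose k) * z k^(N+p))"
      unfolding sum_distrib_left
    proof (rule sum.cong [OF refl])
      fix k assume "k \<in> {..N}"
      then have k: "k \<le> N" by simp
      then have "z k^(N+p) = z k^(k+p) * z k^(N-k)" by (simp add: add.commute flip: power_add)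
      then show "fact N * g k (N - k) = (-1)^(N-k) * real (N choose k) * z k^(N+p)"
        by (simp add: g_def binomial_fact [OF k] power_minus [of "z k"])
    qed
    also have "\<dots> = fact N * d N" unfolding z_def by (rule d)
    finally show ?thesis by simp
  qed
  ultimately show ?thesis using \<open>d sums S\<close> by (simp add: z_def sums_iff)
qed

text \<open>The diagonals are \<open>b^N\<close>, so the value is a geometric series and independent
  of \<open>a\<close>.\<close>

lemma abel_sums_0:
  fixes a b :: real
  assumes "a \<ge> 0" "0 \<le> b" "b \<le> 1/16"
  shows "(\<lambda>k. (a + real k * b)^k * exp (- (a + real k * b)) / fact k) sums (1 / (1 - b))"
  using abel_sums_fwd_diff [OF assms, of 0 "\<lambda>N. b^N" "1 / (1 - b)"] fwd_diff_power_eq geometric_sums [of b] assms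
  by simp

lemma sums_Suc_power:
  fixes b :: real
  assumes "\<bar>b\<bar> < 1"
  shows "(\<lambda>n. real (Suc n) * b^n) sums (1 / (1 - b)\<^sup>2)"
  using geometric_deriv_sums [of b] assms by simp

lemma abel_sums_1:
  fixes a b :: real
  assumes "a \<ge> 0" "0 \<le> b" "b \<le> 1/16"
  shows "(\<lambda>k. (a + real k * b)^Suc k * exp (- (a + real k * b)) / fact k)
    sums (a / (1 - b)\<^sup>2 + b\<^sup>2 / (1 - b)^3)"
proof -
  have b: "\<bar>b\<bar> < 1" using assms by simp
  \<comment> \<open>\<open>c2\<close> is the Cauchy product of the series of
    \<open>1/(1-b)^2\<close> and \<open>1/(1-b)\<close>, hence the coefficient sequence of
    \<open>1/(1-b)^3\<close>.\<close>
  define c2 where "c2 n = (\<Sum>i\<le>n. real (Suc i) * b^i * b^(n-i))" for n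
  have c2: "c2 n = real (Suc n) * real (n+2) / 2 * b^n" for n
  proof -
    have "c2 n = (\<Sum>i\<le>n. real (Suc i)) * b^n"
      unfolding c2_def sum_distrib_right by (rule sum.cong) (auto simp: mult.assoc simp flip: power_add)
    also have "(\<Sum>i\<le>n. real (Suc i)) = real (Suc n) * real (n+2) / 2"
      by (induction n) (auto simp: field_simps)
    finally show ?thesis .
  qed
  have "c2 sums (1 / (1-b)\<^sup>2 * (1 / (1-b)))"
  proof -
    have "summable (\<lambda>n. norm (real (Suc n) * b^n))" "summable (\<lambda>n. norm (b^n))"
      using sums_Suc_power [of "\<bar>b\<bar>"] summable_geometric [of "\<bar>b\<bar>"] b
      by (auto simp: sums_iff abs_mult power_abs)
    from Cauchy_product_sums [OF this] show ?thesis
      using sums_Suc_power [OF b] geometric_sums [of b] b by (simp add: c2_def [abs_def] sums_iff)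
  qed
  then have 2: "(\<lambda>n. b * b * c2 n) sums (b\<^sup>2 / (1-b)^3)"
    by (drule_tac sums_mult [where c = "b*b"]) (simp add: power2_eq_square power3_eq_cube)
  \<comment> \<open>\<open>h\<close> is the part of the diagonal sums that does not involve
    \<open>a\<close>; since \<open>h 0 = 0\<close>, its series is that of
    \<open>b\<^sup>2 c2\<close> shifted by one.\<close>
  define h where "h n = real n * real (Suc n) / 2 * b^Suc n" for n
  have "(\<lambda>n. h (Suc n)) = (\<lambda>n. b * b * c2 n)" by (auto simp: h_def c2 field_simps)
  then have "h sums (b\<^sup>2 / (1-b)^3)"
    using 2 sums_Suc_iff [of h] by (simp add: h_def [of 0])
  from sums_add [OF sums_mult [OF sums_Suc_power [OF b], of a] this]
  have s: "(\<lambda>n. real (Suc n) * b^n * (a + real n * b / 2)) sums (a / (1 - b)\<^sup>2 + b\<^sup>2 / (1 - b)^3)"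
    by (simp add: h_def algebra_simps add_divide_distrib)
  show ?thesis
    using abel_sums_fwd_diff [OF assms, of 1, OF _ _ s] fwd_diff_power_Suc [of _ a b]
    by (simp add: algebra_simps)
qed

subsection \<open>Moments of the Jain weights\<close>

lemma omega_beta_nonneg:
  assumes "0 \<le> b" "0 \<le> y" shows "0 \<le> omega_beta b k y"
  using assms by (simp add: omega_beta_def)

text \<open>Writing \<open>y = (y + k\<beta>) - k\<beta>\<close> in the Jain weight splits it into two Abel terms, based at
  \<open>y\<close> and at \<open>y + \<beta>\<close>.\<close>

lemma omega_beta_sums_0:
  assumes "0 \<le> b" "b \<le> 1/16" "0 \<le> y"
  shows "(\<lambda>k. omega_beta b (Suc k) y) sums (1 - exp (- y))"
proof -
  define F where "F a k = (a + real k * b)^k * exp (- (a + real k * b)) / fact k" for a k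
  \<comment> \<open>The weights start at \<open>v = 1\<close>, so the Abel term
    \<open>F y 0 = exp (- y)\<close> is removed; this is the mass that the operator places at
    0.\<close>
  have "(\<lambda>k. F y (Suc k)) sums (1 / (1-b) - F y 0)"
    using abel_sums_0 [OF assms(3,1,2)] unfolding F_def [symmetric] by (simp add: sums_Suc_iff)
  moreover have "(\<lambda>k. b * F (y+b) k) sums (b * (1 / (1-b)))"
    using abel_sums_0 [of "y+b" b] assms unfolding F_def [abs_def] by (intro sums_mult) simp
  ultimately have s: "(\<lambda>k. F y (Suc k) - b * F (y+b) k) sums (1 / (1-b) - F y 0 - b * (1 / (1-b)))"
    by (rule sums_diff)
  have "F y (Suc k) - b * F (y+b) k = omega_beta b (Suc k) y" for k
  proof -
    have e: "y + b + real k * b = y + real (Suc k) * b" by (simp add: algebra_simps)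
    show ?thesis unfolding F_def omega_beta_def e by (simp add: divide_simps) (simp add: algebra_simps)
  qed
  moreover have "1 / (1-b) - F y 0 - b * (1 / (1-b)) = 1 - exp (- y)"
    using assms by (simp add: F_def divide_simps) (simp add: algebra_simps)
  ultimately show ?thesis using s by simp
qed

lemma omega_beta_sums_1:
  assumes "0 \<le> b" "b \<le> 1/16" "0 \<le> y"
  shows "(\<lambda>k. real (Suc k) * omega_beta b (Suc k) y) sums (y / (1 - b))"
proof -
  \<comment> \<open>The factor \<open>v = k + 1\<close> cancels against \<open>v!\<close>, leaving
    an Abel series based at \<open>y + b\<close>.\<close>
  have "(\<lambda>k. y * ((y + b + real k * b)^k * exp (- (y + b + real k * b)) / fact k)) sums (y * (1 / (1 - b)))"
    using assms by (intro sums_mult abel_sums_0) auto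
  moreover have "y * ((y + b + real k * b)^k * exp (- (y + b + real k * b)) / fact k)
     = real (Suc k) * omega_beta b (Suc k) y" for k
  proof -
    have e: "y + b + real k * b = y + real (Suc k) * b" by (simp add: algebra_simps)
    show ?thesis unfolding omega_beta_def e by (simp del: of_nat_Suc)
  qed
  ultimately show ?thesis by simp
qed

text \<open>The factor \<open>v (v + 1)\<close> is the one occurring in the second Baskakov moment.
  It is split as \<open>v (v - 1) + 2 v\<close>: the first part cancels two factors of
  \<open>v!\<close> and leaves the Abel series of \<open>abel_sums_1\<close> at
  \<open>y + 2 b\<close>, the second is the first moment.\<close>

lemma omega_beta_sums_2:
  assumes "0 \<le> b" "b \<le> 1/16" "0 \<le> y"
  shows "(\<lambda>k. real (Suc k) * real (Suc (Suc k)) * omega_beta b (Suc k) y)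
    sums (y\<^sup>2 / (1-b)\<^sup>2 + y / (1-b)^3 + y / (1-b))"
proof -
  define h where "h k = real k * real (Suc k) * omega_beta b (Suc k) y" for k
  have "(\<lambda>k. y * ((y + 2*b + real k * b)^Suc k * exp (- (y + 2*b + real k * b)) / fact k))
     sums (y * ((y + 2*b) / (1 - b)\<^sup>2 + b\<^sup>2 / (1 - b)^3))"
    using assms by (intro sums_mult abel_sums_1) auto
  moreover have "y * ((y + 2*b + real k * b)^Suc k * exp (- (y + 2*b + real k * b)) / fact k) = h (Suc k)" for k
  proof -
    have e: "y + 2*b + real k * b = y + real (Suc (Suc k)) * b" by (simp add: algebra_simps)
    show ?thesis unfolding h_def omega_beta_def e by (simp del: of_nat_Suc)
  qed
  ultimately have "h sums (y * ((y + 2*b) / (1 - b)\<^sup>2 + b\<^sup>2 / (1 - b)^3))"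
    using sums_Suc_iff [of h] by (simp add: h_def [of 0])
  from sums_add [OF this sums_mult [OF omega_beta_sums_1 [OF assms], of 2]]
  have "(\<lambda>k. h k + 2 * (real (Suc k) * omega_beta b (Suc k) y))
     sums (y * ((y + 2*b) / (1 - b)\<^sup>2 + b\<^sup>2 / (1 - b)^3) + 2 * (y / (1 - b)))" .
  moreover have "y * ((y + 2*b) / (1 - b)\<^sup>2 + b\<^sup>2 / (1 - b)^3) + 2 * (y / (1 - b))
     = y\<^sup>2 / (1-b)\<^sup>2 + y / (1-b)^3 + y / (1-b)"
  proof -
    define r where "r = 1 - b"
    have r: "r \<noteq> 0" "b = 1 - r" using assms by (auto simp: r_def)
    show ?thesis unfolding r_def [symmetric] unfolding r(2) using r(1)
      by (simp add: field_simps power2_eq_square power3_eq_cube)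
  qed
  moreover have "h k + 2 * (real (Suc k) * omega_beta b (Suc k) y)
     = real (Suc k) * real (Suc (Suc k)) * omega_beta b (Suc k) y" for k
    by (simp add: h_def algebra_simps)
  ultimately show ?thesis by simp
qed

subsection \<open>Moments of the Baskakov kernel\<close>

text \<open>A Beta integral, obtained by induction on \<open>k\<close> for all \<open>s\<close> at
  once: \<open>z / (1 + z) = 1 - 1 / (1 + z)\<close> with \<open>z = c t\<close> reduces
  \<open>k + 1\<close> at \<open>s\<close> to \<open>k\<close> at \<open>s - 1\<close> and at
  \<open>s\<close>. The base case has an explicit antiderivative vanishing at infinity.\<close>

lemma has_bochner_integral_baskakov:
  fixes c s :: real
  assumes "c > 0" "s > real k + 1"
  shows "has_bochner_integral lborel (\<lambda>t. indicator {0..} t * ((c * t)^k / (1 + c * t) powr s))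
    (fact k * Gamma (s - real k - 1) / (c * Gamma s))"
  using assms(2)
proof (induction k arbitrary: s)
  case 0
  define F where "F t = - ((1 + c * t) powr (1 - s) / (c * (s - 1)))" for t
  have "(\<integral>\<^sup>+t. ennreal ((1 + c * t) powr (- s)) * indicator {0..} t \<partial>lborel) = ennreal (0 - F 0)"
  proof (rule nn_integral_FTC_atLeast)
    show "(\<lambda>t. (1 + c * t) powr (- s)) \<in> borel_measurable borel" by measurable
    show "(F has_real_derivative (1 + c * t) powr (- s)) (at t)" if "0 \<le> t" for t
    proof -
      have "1 + c * t > 0" using \<open>c > 0\<close> that by (simp add: add_pos_nonneg)
      then have "((\<lambda>t. (1 + c * t) powr (1 - s)) has_real_derivative (1 - s) * (1 + c * t) powr (1 - s - 1) * c) (at t)"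
        by (intro DERIV_chain2 [OF has_real_derivative_powr]) (auto intro!: derivative_eq_intros)
      from DERIV_minus [OF DERIV_cdivide [OF this, of "c * (s - 1)"]]
      show ?thesis unfolding F_def by (rule DERIV_cong) (use 0 \<open>c > 0\<close> in \<open>simp add: field_simps\<close>)
    qed
    have "filterlim (\<lambda>t. 1 + c * t) at_top at_top"
      using \<open>c > 0\<close>
      by (intro filterlim_tendsto_add_at_top [OF tendsto_const]
          filterlim_tendsto_pos_mult_at_top [OF tendsto_const] filterlim_ident)
    then have "((\<lambda>t. (1 + c * t) powr (1 - s)) \<longlongrightarrow> 0) at_top"
      using 0 by (intro tendsto_neg_powr) auto
    from tendsto_minus [OF tendsto_divide_zero [OF this]]
    show "(F \<longlongrightarrow> 0) at_top" unfolding F_def by simp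
  qed auto
  moreover have "0 \<le> - F 0" using \<open>c > 0\<close> 0 by (simp add: F_def)
  ultimately have "has_bochner_integral lborel (\<lambda>t. indicator {0..} t * (1 + c * t) powr (- s)) (- F 0)"
    by (intro has_bochner_integral_nn_integral)
      (auto simp: ennreal_mult' ennreal_indicator mult.commute)
  moreover have "Gamma s = (s - 1) * Gamma (s - 1)"
    using 0 Gamma_plus1 [of "s - 1"] by (auto simp: nonpos_Ints_def)
  moreover have "Gamma (s - 1) > 0" using 0 by (intro Gamma_real_pos) simp
  ultimately show ?case by (simp add: F_def powr_minus divide_inverse mult_ac)
next
  case (Suc k)
  define r where "r = s - 1"
  have s: "s = r + 1" and r: "r > real k + 1" using Suc.prems by (auto simp: r_def)
  have "indicator {0..} t * ((c * t)^Suc k / (1 + c * t) powr s)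
    = indicator {0..} t * ((c * t)^k / (1 + c * t) powr r) - indicator {0..} t * ((c * t)^k / (1 + c * t) powr s)" for t
  proof (cases "t \<ge> 0")
    case True
    then have "1 + c * t > 0" using \<open>c > 0\<close> by (simp add: add_pos_nonneg)
    moreover have "X * z / (Q * (1 + z)) = X / Q - X / (Q * (1 + z))" if "Q \<noteq> 0" "1 + z \<noteq> 0" for X z Q :: real
      using that by (simp add: divide_simps) (simp add: algebra_simps)
    from this [of "(1 + c * t) powr r" "c * t" "(c * t)^k"] calculation
    have "(c * t)^Suc k / (1 + c * t) powr s = (c * t)^k / (1 + c * t) powr r - (c * t)^k / (1 + c * t) powr s"
      by (simp add: s powr_add mult_ac)
    then show ?thesis by (simp only: right_diff_distrib)
  qed simp
  moreover have "fact (Suc k) * Gamma (s - real (Suc k) - 1) / (c * Gamma s)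
    = fact k * Gamma (r - real k - 1) / (c * Gamma r) - fact k * Gamma (s - real k - 1) / (c * Gamma s)"
  proof -
    have 1: "Gamma s = r * Gamma r"
      unfolding s using r by (intro Gamma_plus1) (auto simp: nonpos_Ints_def)
    have "Gamma (r - real k - 1 + 1) = (r - real k - 1) * Gamma (r - real k - 1)"
      using r by (intro Gamma_plus1) (auto simp: nonpos_Ints_def)
    then have 2: "Gamma (s - real k - 1) = (r - real k - 1) * Gamma (r - real k - 1)" by (simp add: s)
    have 3: "s - real (Suc k) - 1 = r - real k - 1" by (simp add: s)
    have "Gamma r \<noteq> 0" "r \<noteq> 0" using r by (auto simp: Gamma_eq_zero_iff nonpos_Ints_def)
    then show ?thesis
      using \<open>c > 0\<close> unfolding 1 2 3 by (simp add: divide_simps) (simp add: algebra_simps)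
  qed
  ultimately show ?case
    using has_bochner_integral_diff [OF Suc.IH [OF r] Suc.IH [of s]] Suc.prems by simp
qed

text \<open>The factor \<open>t^m\<close> raises the power of \<open>c t\<close> from
  \<open>k\<close> to \<open>k + m\<close>, at the cost of \<open>c^m\<close>; the hypothesis on
  \<open>n\<close> is exactly the integrability condition at infinity.\<close>

lemma p_JB_moment:
  fixes c :: real
  assumes "c > 0" "real n > (real m + 1) * c"
  shows "has_bochner_integral lborel (\<lambda>t. indicator {0..} t * (p_JB n (Suc k) c t * t^m))
    (fact (k + m) / fact k * Gamma (real n / c - real m - 1) / (Gamma (real n / c) * c^m))"
proof -
  define a where "a = real n / c"
  have a: "a > real m + 1" using assms by (simp add: a_def field_simps)
  define C where "C = c * Gamma (a + real k) / (fact k * Gamma a) / c^m"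
  have "has_bochner_integral lborel
      (\<lambda>t. C * (indicator {0..} t * ((c * t)^(k+m) / (1 + c * t) powr (a + real k))))
      (C * (fact (k+m) * Gamma (a + real k - real (k+m) - 1) / (c * Gamma (a + real k))))"
    using a assms(1) by (intro has_bochner_integral_mult_right has_bochner_integral_baskakov) auto
  moreover have "C * (indicator {0..} t * ((c * t)^(k+m) / (1 + c * t) powr (a + real k)))
      = indicator {0..} t * (p_JB n (Suc k) c t * t^m)" for t
  proof -
    have e: "real n / c + real (Suc k) - 1 = a + real k" by (simp add: a_def)
    have g: "Gamma (real (Suc k)) = fact k" using Gamma_fact [where 'a = real, of k] by simp
    show ?thesis unfolding p_JB_def e g C_def a_def [symmetric] using \<open>c > 0\<close>
      by (simp add: power_add power_mult_distrib)
  qed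
  moreover have "C * (fact (k+m) * Gamma (a + real k - real (k+m) - 1) / (c * Gamma (a + real k)))
      = fact (k + m) / fact k * Gamma (a - real m - 1) / (Gamma a * c^m)"
  proof -
    have "Gamma (a + real k) > 0" using a by (intro Gamma_real_pos) auto
    then show ?thesis using \<open>c > 0\<close> by (simp add: C_def)
  qed
  ultimately show ?thesis by (simp add: a_def)
qed

lemma p_JB_nonneg:
  assumes "c > 0" "n > 0" "t \<ge> 0" shows "0 \<le> p_JB n (Suc k) c t"
proof -
  have "Gamma (real n / c + real k) > 0" "Gamma (real n / c) > 0" "Gamma (real (Suc k)) > 0"
    using assms by (auto intro!: Gamma_real_pos add_pos_nonneg)
  then show ?thesis using assms by (simp add: p_JB_def)
qed

text \<open>With \<open>a = n / c\<close>, the prefactor \<open>(n - c) / c = a - 1\<close>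
  normalises the kernel to a probability density. The moments follow by unwinding
  \<open>Gamma a\<close> down to \<open>Gamma (a - 3)\<close>; \<open>n > 3 c\<close> makes the
  second one finite.\<close>

lemma p_JB_moments:
  fixes c :: real
  assumes "c > 0" "real n > 3 * c"
  defines "q \<equiv> \<lambda>k t. indicator {0..} t * ((real n - c) / c * p_JB n (Suc k) c t)"
  shows "has_bochner_integral lborel (q k) 1"
    and "has_bochner_integral lborel (\<lambda>t. q k t * t) (real (Suc k) / (real n - 2 * c))"
    and "has_bochner_integral lborel (\<lambda>t. q k t * t\<^sup>2)
      (real (Suc k) * real (Suc (Suc k)) / ((real n - 2 * c) * (real n - 3 * c)))"
proof -
  define a where "a = real n / c"
  have a: "a > 3" and n: "real n = c * a" using assms by (auto simp: a_def field_simps)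
  have G: "Gamma a = (a - 1) * Gamma (a - 1)" "Gamma (a - 1) = (a - 2) * Gamma (a - 2)"
    "Gamma (a - 2) = (a - 3) * Gamma (a - 3)"
    using a Gamma_plus1 [of "a - 1"] Gamma_plus1 [of "a - 2"] Gamma_plus1 [of "a - 3"]
    by (auto simp: nonpos_Ints_def)
  have pos: "Gamma (a - 1) \<noteq> 0" "Gamma (a - 2) \<noteq> 0" "Gamma (a - 3) \<noteq> 0"
    using a by (auto simp: Gamma_eq_zero_iff nonpos_Ints_def)
  have q: "has_bochner_integral lborel (\<lambda>t. q k t * t^m)
    ((a - 1) * (fact (k + m) / fact k * Gamma (a - real m - 1) / (Gamma a * c^m)))" if "m \<le> 2" for m
  proof -
    have "real n > (real m + 1) * c"
      using that assms(1) by (intro le_less_trans [OF _ assms(2)] mult_right_mono) auto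
    from has_bochner_integral_mult_right [OF p_JB_moment [OF assms(1) this], of "a - 1"]
    show ?thesis using \<open>c > 0\<close> by (simp add: q_def n diff_divide_distrib mult_ac)
  qed
  show "has_bochner_integral lborel (q k) 1"
    using q [of 0] a pos by (simp add: G(1))
  have "(a - 1) * (fact (k + 1) / fact k * Gamma (a - real 1 - 1) / (Gamma a * c^1))
     = real (Suc k) / (real n - 2 * c)"
    unfolding G(1) unfolding G(2) using a pos \<open>c > 0\<close> by (simp add: n divide_simps) (simp add: algebra_simps)
  then show "has_bochner_integral lborel (\<lambda>t. q k t * t) (real (Suc k) / (real n - 2 * c))"
    using q [of 1] by simp
  have "(a - 1) * (fact (k + 2) / fact k * Gamma (a - real 2 - 1) / (Gamma a * c^2))
     = real (Suc k) * real (Suc (Suc k)) / ((real n - 2 * c) * (real n - 3 * c))"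
    unfolding G(1) unfolding G(2) unfolding G(3) using a pos \<open>c > 0\<close>
    by (simp add: n divide_simps) (simp add: algebra_simps power2_eq_square)
  then show "has_bochner_integral lborel (\<lambda>t. q k t * t\<^sup>2)
      (real (Suc k) * real (Suc (Suc k)) / ((real n - 2 * c) * (real n - 3 * c)))"
    using q [of 2] by simp
qed

section \<open>Deviation estimates from quadratic majorants\<close>

text \<open>Since \<open>q\<close> has total mass 1, the constant \<open>b\<close> can be taken
  under the integral; the majorant then integrates to its combination of the three moments.\<close>

lemma p_JB_deviation:
  fixes c b :: real and f :: "real \<Rightarrow> real"
  assumes "c > 0" "real n > 3 * c" and cont: "continuous_on {0..} f"
    and f: "\<And>t. t \<ge> 0 \<Longrightarrow> \<bar>f t - b\<bar> \<le> g0 + g1 * t + g2 * t\<^sup>2"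
  shows "\<bar>(real n - c) / c * (LINT t:{0..}|lborel. p_JB n (Suc k) c t * f t) - b\<bar>
    \<le> g0 + g1 * (real (Suc k) / (real n - 2 * c))
       + g2 * (real (Suc k) * real (Suc (Suc k)) / ((real n - 2 * c) * (real n - 3 * c)))"
    (is "_ \<le> ?G")
proof -
  define q where "q t = indicator {0..} t * ((real n - c) / c * p_JB n (Suc k) c t)" for t
  note mom = p_JB_moments [OF assms(1,2), of k, folded q_def]
  have n: "n > 0" using assms(1,2) by (cases n) auto
  have q0: "q t \<ge> 0" for t
    using assms(1,2) p_JB_nonneg [OF assms(1) n, of t k] by (auto simp: q_def indicator_def)
  have G: "has_bochner_integral lborel (\<lambda>t. q t * (g0 + g1 * t + g2 * t\<^sup>2)) ?G"
    using has_bochner_integral_add [OF has_bochner_integral_add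
        [OF has_bochner_integral_mult_right [OF mom(1), of g0] has_bochner_integral_mult_right [OF mom(2), of g1]]
        has_bochner_integral_mult_right [OF mom(3), of g2]]
    by (simp add: algebra_simps)
  \<comment> \<open>Nothing is known about \<open>f\<close> on the negative axis, so only its
    cut-off is measurable; \<open>q\<close> vanishes there, which makes the two products
    agree.\<close>
  have "(\<lambda>t. indicator {0..} t *\<^sub>R f t) \<in> borel_measurable lborel"
    using borel_measurable_continuous_on_indicator [OF _ cont] by simp
  moreover have "q \<in> borel_measurable lborel" by (rule borel_measurable_integrable [OF integrable.intros [OF mom(1)]])
  ultimately have "(\<lambda>t. q t * (indicator {0..} t *\<^sub>R f t - b)) \<in> borel_measurable lborel" by simp
  moreover have "(\<lambda>t. q t * (indicator {0..} t *\<^sub>R f t - b)) = (\<lambda>t. q t * (f t - b))"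
    by (simp add: q_def indicator_def fun_eq_iff)
  ultimately have m: "(\<lambda>t. q t * (f t - b)) \<in> borel_measurable lborel" by simp
  have bd: "\<bar>q t * (f t - b)\<bar> \<le> q t * (g0 + g1 * t + g2 * t\<^sup>2)" for t
  proof (cases "t \<ge> 0")
    case True
    then show ?thesis using q0 [of t] f [of t] by (simp add: abs_mult mult_left_mono)
  qed (simp add: q_def)
  have int: "integrable lborel (\<lambda>t. q t * (f t - b))"
    by (rule Bochner_Integration.integrable_bound [OF integrable.intros [OF G] m])
      (use bd in \<open>auto intro: order_trans [OF _ abs_ge_self]\<close>)
  have "\<bar>LINT t|lborel. q t * (f t - b)\<bar> \<le> (LINT t|lborel. \<bar>q t * (f t - b)\<bar>)"
    by (rule integral_abs_bound)
  also have "\<dots> \<le> (LINT t|lborel. q t * (g0 + g1 * t + g2 * t\<^sup>2))"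
    using int G bd by (intro integral_mono) (auto simp: has_bochner_integral_iff)
  also have "\<dots> = ?G" using G by (simp add: has_bochner_integral_iff)
  finally have *: "\<bar>LINT t|lborel. q t * (f t - b)\<bar> \<le> ?G" .
  have "(LINT t|lborel. q t * f t) = (LINT t|lborel. q t * (f t - b) + b * q t)"
    by (simp add: algebra_simps)
  also have "\<dots> = (LINT t|lborel. q t * (f t - b)) + b"
    using int mom(1) by (subst Bochner_Integration.integral_add) (auto simp: has_bochner_integral_iff)
  finally have "(LINT t|lborel. q t * (f t - b)) = (LINT t|lborel. q t * f t) - b" by simp
  moreover have "(LINT t|lborel. q t * f t)
     = (real n - c) / c * (LINT t:{0..}|lborel. p_JB n (Suc k) c t * f t)"
    unfolding set_lebesgue_integral_def q_def
    by (subst integral_mult_right_zero [symmetric]) (simp add: mult_ac)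
  ultimately show ?thesis using * by simp
qed

text \<open>The Jain weights have mass \<open>1 - exp (- y)\<close>, and the atom
  \<open>exp (- y)\<close> at 0 completes it to 1. At the atom the hypothesis for
  \<open>t = 0\<close> gives \<open>\<bar>f 0 - b\<bar> <= g0\<close>, so the coefficient of
  \<open>g0\<close> is exactly 1.\<close>

lemma D_op_deviation:
  fixes c b \<beta> x :: real and f :: "real \<Rightarrow> real"
  assumes "c > 0" "real n > 3 * c" and \<beta>: "0 \<le> \<beta>" "\<beta> \<le> 1/16" and "x \<ge> 0"
    and cont: "continuous_on {0..} f"
    and f: "\<And>t. t \<ge> 0 \<Longrightarrow> \<bar>f t - b\<bar> \<le> g0 + g1 * t + g2 * t\<^sup>2"
  defines "y \<equiv> real n * x"
  shows "\<bar>D_op n c \<beta> f x - b\<bar> \<le> g0 + g1 * (y / (1 - \<beta>) / (real n - 2 * c))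
    + g2 * ((y\<^sup>2 / (1 - \<beta>)\<^sup>2 + y / (1 - \<beta>)^3 + y / (1 - \<beta>)) / ((real n - 2 * c) * (real n - 3 * c)))"
proof -
  define w where "w k = omega_beta \<beta> (Suc k) y" for k
  define I where "I k = (LINT t:{0..}|lborel. p_JB n (Suc k) c t * f t)" for k
  define E where "E k = (real n - c) / c * I k" for k
  define M1 where "M1 = y / (1 - \<beta>)"
  define M2 where "M2 = y\<^sup>2 / (1 - \<beta>)\<^sup>2 + y / (1 - \<beta>)^3 + y / (1 - \<beta>)"
  define d1 where "d1 = real n - 2 * c"
  define d2 where "d2 = (real n - 2 * c) * (real n - 3 * c)"
  have y: "y \<ge> 0" using assms by simp
  have w0: "w k \<ge> 0" for k using omega_beta_nonneg [OF \<beta>(1) y] by (simp add: w_def)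
  note S0 = omega_beta_sums_0 [OF \<beta> y, folded w_def]
    and S1 = omega_beta_sums_1 [OF \<beta> y, folded w_def, folded M1_def]
    and S2 = omega_beta_sums_2 [OF \<beta> y, folded w_def, folded M2_def]
  define G where "G k = w k * (g0 + g1 * (real (Suc k) / d1) + g2 * (real (Suc k) * real (Suc (Suc k)) / d2))" for k
  have "G sums (g0 * (1 - exp (- y)) + g1 / d1 * M1 + g2 / d2 * M2)"
    using sums_add [OF sums_add [OF sums_mult [OF S0, of g0] sums_mult [OF S1, of "g1/d1"]]
        sums_mult [OF S2, of "g2/d2"]]
    by (rule back_subst [of "\<lambda>h. h sums _"]) (auto simp: G_def fun_eq_iff algebra_simps add_divide_distrib)
  then have G: "summable G" "suminf G = g0 * (1 - exp (- y)) + g1 * (M1 / d1) + g2 * (M2 / d2)"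
    by (auto simp: sums_iff)
  have bd: "norm (w k * (E k - b)) \<le> G k" for k
    using p_JB_deviation [OF assms(1,2) cont f, of k] w0 [of k]
    by (simp add: G_def E_def I_def d1_def d2_def abs_mult mult_left_mono del: of_nat_Suc)
  have sm: "summable (\<lambda>k. w k * (E k - b))"
    by (rule summable_comparison_test' [OF G(1)]) (rule bd)
  define T where "T = (\<Sum>k. w k * (E k - b))"
  have T: "\<bar>T\<bar> \<le> suminf G"
    unfolding T_def using norm_suminf_le [of "\<lambda>k. w k * (E k - b)", OF bd G(1)] by simp
  \<comment> \<open>Dividing by \<open>(n - c) / c\<close> returns from the normalised means
    \<open>E\<close> to the integrals \<open>I\<close>, because the operator has this factor outside
    its series.\<close>
  have "(\<lambda>k. c / (real n - c) * (w k * (E k - b) + b * w k)) sums (c / (real n - c) * (T + b * (1 - exp (- y))))"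
    unfolding T_def by (intro sums_mult sums_add summable_sums sm S0)
  moreover have "c / (real n - c) * (w k * (E k - b) + b * w k) = w k * I k" for k
    using assms(1,2) by (simp add: E_def field_simps)
  ultimately have "(\<Sum>k. w k * I k) = c / (real n - c) * (T + b * (1 - exp (- y)))"
    by (simp add: sums_iff)
  then have "D_op n c \<beta> f x = T + b * (1 - exp (- y)) + exp (- y) * f 0"
    using assms(1,2) by (simp add: D_op_def w_def I_def y_def)
  then have "\<bar>D_op n c \<beta> f x - b\<bar> = \<bar>T + exp (- y) * (f 0 - b)\<bar>" by (simp add: algebra_simps)
  also have "\<dots> \<le> \<bar>T\<bar> + exp (- y) * \<bar>f 0 - b\<bar>"
    by (rule order_trans [OF abs_triangle_ineq]) (simp add: abs_mult)
  also have "\<dots> \<le> suminf G + exp (- y) * g0"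
    using T f [of 0] by (intro add_mono mult_left_mono) auto
  also have "\<dots> = g0 + g1 * (M1 / d1) + g2 * (M2 / d2)" by (simp add: G algebra_simps)
  finally show ?thesis by (simp add: M1_def M2_def d1_def d2_def)
qed

subsection \<open>Convergence in the weighted norm\<close>

lemma deviation_le_quadratic:
  fixes f :: "real \<Rightarrow> real"
  assumes cont: "continuous_on {0..} f" and M: "\<And>t. t \<ge> 0 \<Longrightarrow> \<bar>f t\<bar> \<le> M * (1 + t\<^sup>2)"
    and "A \<ge> 0" "e > 0"
  obtains K where "K \<ge> 0"
    "\<And>x t. 0 \<le> x \<Longrightarrow> x \<le> A \<Longrightarrow> 0 \<le> t \<Longrightarrow> \<bar>f t - f x\<bar> \<le> e + K * (t - x)\<^sup>2"
proof -
  have M0: "M \<ge> 0" using M [of 0] by simp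
  have "uniformly_continuous_on {0..A+1} f"
    by (intro compact_uniformly_continuous continuous_on_subset [OF cont]) auto
  then obtain d where d: "d > 0"
    "\<And>x t. x \<in> {0..A+1} \<Longrightarrow> t \<in> {0..A+1} \<Longrightarrow> dist t x < d \<Longrightarrow> dist (f t) (f x) < e"
    using \<open>e > 0\<close> unfolding uniformly_continuous_on_def by metis
  \<comment> \<open>The cap at 1 keeps \<open>t\<close> inside \<open>[0, A + 1]\<close> whenever
    \<open>\<bar>t - x\<bar> < r\<close>, so that uniform continuity applies.\<close>
  define r where "r = min d 1"
  have r: "0 < r" "r \<le> d" "r \<le> 1" using d by (auto simp: r_def)
  define B where "B = M * (2 + 3 * A\<^sup>2)"
  define K where "K = B / r\<^sup>2 + 2 * M"
  have B0: "B \<ge> 0" using M0 by (simp add: B_def)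
  have K0: "K \<ge> 0" using M0 B0 by (simp add: K_def)
  show ?thesis
  proof (rule that [OF K0])
    fix x t :: real assume *: "0 \<le> x" "x \<le> A" "0 \<le> t"
    show "\<bar>f t - f x\<bar> \<le> e + K * (t - x)\<^sup>2"
    proof (cases "\<bar>t - x\<bar> < r")
      case True
      then have "\<bar>f t - f x\<bar> < e" using d(2) [of x t] * r by (auto simp: dist_real_def)
      moreover have "0 \<le> K * (t - x)\<^sup>2" using K0 by simp
      ultimately show ?thesis by linarith
    next
      case False
      \<comment> \<open>Away from \<open>x\<close> even a constant is dominated by a multiple of
        \<open>(t - x)\<^sup>2\<close>; the growth bound supplies the constant \<open>B\<close> and
        the extra \<open>2 M (t - x)\<^sup>2\<close>.\<close>
      then have "r\<^sup>2 \<le> \<bar>t - x\<bar>\<^sup>2" using r by (intro power_mono) auto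
      then have "1 \<le> (t - x)\<^sup>2 / r\<^sup>2" using r by simp
      then have 1: "B \<le> B * ((t - x)\<^sup>2 / r\<^sup>2)" using B0 mult_left_mono by fastforce
      have "0 \<le> (t - 2 * x)\<^sup>2" by simp
      then have "t\<^sup>2 \<le> 2 * (t - x)\<^sup>2 + 2 * x\<^sup>2" by (simp add: power2_eq_square algebra_simps)
      moreover have "x\<^sup>2 \<le> A\<^sup>2" using * by (intro power_mono) auto
      ultimately have "(1 + t\<^sup>2) + (1 + x\<^sup>2) \<le> (2 + 3 * A\<^sup>2) + 2 * (t - x)\<^sup>2" by linarith
      then have "M * ((1 + t\<^sup>2) + (1 + x\<^sup>2)) \<le> M * ((2 + 3 * A\<^sup>2) + 2 * (t - x)\<^sup>2)"
        using M0 by (rule mult_left_mono)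
      then have "\<bar>f t - f x\<bar> \<le> B + 2 * M * (t - x)\<^sup>2"
        using M [of t] M [of x] * by (simp add: B_def algebra_simps)
      also have "\<dots> \<le> K * (t - x)\<^sup>2" using 1 by (simp add: K_def algebra_simps)
      finally show ?thesis using \<open>e > 0\<close> by linarith
    qed
  qed
qed

text \<open>These are the coefficients in the images \<open>r1 x\<close> of \<open>t\<close> and
  \<open>r2 x\<^sup>2 + s x\<close> of \<open>t\<^sup>2\<close>. Written in \<open>u = 1/n\<close>
  they are continuous at \<open>u = 0\<close>, \<open>\<beta> = 0\<close>; the third keeps a spare
  factor \<open>u\<close>.\<close>

lemma moment_coefficients_tendsto:
  fixes c :: real and \<beta> :: "nat \<Rightarrow> real"
  assumes "\<beta> \<longlonglongrightarrow> 0"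
  shows "(\<lambda>n. real n / ((1 - \<beta> n) * (real n - 2 * c))) \<longlonglongrightarrow> 1"
    and "(\<lambda>n. (real n)\<^sup>2 / ((1 - \<beta> n)\<^sup>2 * ((real n - 2 * c) * (real n - 3 * c)))) \<longlonglongrightarrow> 1"
    and "(\<lambda>n. (real n / (1 - \<beta> n)^3 + real n / (1 - \<beta> n)) / ((real n - 2 * c) * (real n - 3 * c))) \<longlonglongrightarrow> 0"
proof -
  define u where "u n = 1 / real n" for n
  have u: "u \<longlonglongrightarrow> 0" unfolding u_def by (rule lim_1_over_n)
  have d: "real n - a = real n * (1 - a * u n)" if "n > 0" for n a
    using that by (simp add: u_def field_simps)
  have "(\<lambda>n. 1 / ((1 - \<beta> n) * (1 - 2 * c * u n))) \<longlonglongrightarrow> 1 / ((1 - 0) * (1 - 2 * c * 0))"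
    by (intro tendsto_intros u assms) auto
  then have "(\<lambda>n. 1 / ((1 - \<beta> n) * (1 - 2 * c * u n))) \<longlonglongrightarrow> 1" by simp
  then show "(\<lambda>n. real n / ((1 - \<beta> n) * (real n - 2 * c))) \<longlonglongrightarrow> 1"
    by (rule Lim_transform_eventually) (auto intro!: eventually_mono [OF eventually_gt_at_top [of 0]] simp: d)
  have "(\<lambda>n. 1 / ((1 - \<beta> n)\<^sup>2 * ((1 - 2 * c * u n) * (1 - 3 * c * u n))))
      \<longlonglongrightarrow> 1 / ((1 - 0)\<^sup>2 * ((1 - 2 * c * 0) * (1 - 3 * c * 0)))"
    by (intro tendsto_intros u assms) auto
  then have "(\<lambda>n. 1 / ((1 - \<beta> n)\<^sup>2 * ((1 - 2 * c * u n) * (1 - 3 * c * u n)))) \<longlonglongrightarrow> 1" by simp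
  then show "(\<lambda>n. (real n)\<^sup>2 / ((1 - \<beta> n)\<^sup>2 * ((real n - 2 * c) * (real n - 3 * c)))) \<longlonglongrightarrow> 1"
    by (rule Lim_transform_eventually)
      (auto intro!: eventually_mono [OF eventually_gt_at_top [of 0]] simp: d power2_eq_square)
  have "(\<lambda>n. u n * ((1 / (1 - \<beta> n)^3 + 1 / (1 - \<beta> n)) / ((1 - 2 * c * u n) * (1 - 3 * c * u n))))
      \<longlonglongrightarrow> 0 * ((1 / (1 - 0)^3 + 1 / (1 - 0)) / ((1 - 2 * c * 0) * (1 - 3 * c * 0)))"
    by (intro tendsto_intros u assms) auto
  then have "(\<lambda>n. u n * ((1 / (1 - \<beta> n)^3 + 1 / (1 - \<beta> n)) / ((1 - 2 * c * u n) * (1 - 3 * c * u n)))) \<longlonglongrightarrow> 0" by simp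
  then show "(\<lambda>n. (real n / (1 - \<beta> n)^3 + real n / (1 - \<beta> n)) / ((real n - 2 * c) * (real n - 3 * c))) \<longlonglongrightarrow> 0"
  proof (rule Lim_transform_eventually)
    show "\<forall>\<^sub>F n in sequentially. u n * ((1 / (1 - \<beta> n)^3 + 1 / (1 - \<beta> n)) / ((1 - 2 * c * u n) * (1 - 3 * c * u n)))
      = (real n / (1 - \<beta> n)^3 + real n / (1 - \<beta> n)) / ((real n - 2 * c) * (real n - 3 * c))"
      using eventually_gt_at_top [of 0]
    proof eventually_elim
      case (elim n)
      have *: "real n / (1 - \<beta> n)^3 + real n / (1 - \<beta> n) = real n * (1 / (1 - \<beta> n)^3 + 1 / (1 - \<beta> n))"
        by (simp add: algebra_simps)
      show ?case unfolding d [OF elim] * using elim by (simp add: u_def)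
    qed
  qed
qed

lemma SUP_ereal_tendsto_0:
  fixes F :: "nat \<Rightarrow> 'a \<Rightarrow> real"
  assumes small: "\<And>e. e > 0 \<Longrightarrow> \<forall>\<^sub>F n in sequentially. \<forall>x\<in>A. F n x \<le> e"
    and F0: "\<And>n x. x \<in> A \<Longrightarrow> F n x \<ge> 0" and "A \<noteq> {}"
  shows "(\<lambda>n. SUP x\<in>A. ereal (F n x)) \<longlonglongrightarrow> 0"
proof -
  let ?S = "\<lambda>n. SUP x\<in>A. ereal (F n x)"
  obtain x0 where x0: "x0 \<in> A" using \<open>A \<noteq> {}\<close> by blast
  have S0: "0 \<le> ?S n" for n
  proof -
    have "0 \<le> ereal (F n x0)" using F0 [OF x0] by simp
    also have "\<dots> \<le> ?S n" using x0 by (rule SUP_upper)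
    finally show ?thesis .
  qed
  show ?thesis
  proof (rule order_tendstoI)
    fix a :: ereal assume "a < 0"
    then have "a < ?S n" for n using S0 [of n] by (rule less_le_trans)
    then show "\<forall>\<^sub>F n in sequentially. a < ?S n" by (rule always_eventually [OF allI])
  next
    fix a :: ereal assume "0 < a"
    \<comment> \<open>A pointwise bound by \<open>e\<close> only gives \<open><=\<close> for the
      supremum, so \<open>e\<close> is taken strictly below \<open>a\<close>.\<close>
    then obtain e where e: "0 < ereal e" "ereal e < a" using ereal_dense2 by blast
    then have "e > 0" by simp
    from small [OF this] show "\<forall>\<^sub>F n in sequentially. ?S n < a"
    proof eventually_elim
      case (elim n)
      then have "?S n \<le> ereal e" by (intro SUP_least) simp
      then show ?case using e(2) by (rule le_less_trans)
    qed
  qed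
qed

theorem theorem4:
  fixes c :: real and \<beta> :: "nat \<Rightarrow> real" and f :: "real \<Rightarrow> real" and lam :: real
  assumes "c > 0"
    and "\<And>n. 0 \<le> \<beta> n \<and> \<beta> n < 1"
    and "\<beta> \<longlonglongrightarrow> 0"
    and "f \<in> C_rho0"
    and "lam > 0"
  shows "(\<lambda>n. SUP x\<in>{0::real..}. ereal (\<bar>D_op n c (\<beta> n) f x - f x\<bar> / (1 + x\<^sup>2) powr (1 + lam)))
           \<longlonglongrightarrow> 0"
proof -
  from \<open>f \<in> C_rho0\<close> obtain M where cont: "continuous_on {0..} f"
    and M: "\<And>t. t \<ge> 0 \<Longrightarrow> \<bar>f t\<bar> \<le> M * (1 + t\<^sup>2)"
    unfolding C_rho0_def by auto
  have M0: "M \<ge> 0" using M [of 0] by simp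
  define r1 where "r1 n = real n / ((1 - \<beta> n) * (real n - 2 * c))" for n
  define r2 where "r2 n = (real n)\<^sup>2 / ((1 - \<beta> n)\<^sup>2 * ((real n - 2 * c) * (real n - 3 * c)))" for n
  define s where "s n = (real n / (1 - \<beta> n)^3 + real n / (1 - \<beta> n)) / ((real n - 2 * c) * (real n - 3 * c))" for n
  note lims = moment_coefficients_tendsto [OF \<open>\<beta> \<longlonglongrightarrow> 0\<close>, of c, folded r1_def r2_def s_def]
  have dev: "\<bar>D_op n c (\<beta> n) f x - b\<bar> \<le> g0 + g1 * (r1 n * x) + g2 * (r2 n * x\<^sup>2 + s n * x)"
    if "real n > 3 * c" "\<beta> n \<le> 1/16" "x \<ge> 0"
      and "\<And>t. t \<ge> 0 \<Longrightarrow> \<bar>f t - b\<bar> \<le> g0 + g1 * t + g2 * t\<^sup>2" for n x b g0 g1 g2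
  proof -
    have "real n * x / (1 - \<beta> n) / (real n - 2 * c) = r1 n * x" by (simp add: r1_def)
    moreover have "((real n * x)\<^sup>2 / (1 - \<beta> n)\<^sup>2 + real n * x / (1 - \<beta> n)^3 + real n * x / (1 - \<beta> n))
        / ((real n - 2 * c) * (real n - 3 * c)) = r2 n * x\<^sup>2 + s n * x"
      unfolding r2_def s_def by (simp add: add_divide_distrib distrib_right power_mult_distrib)
    ultimately show ?thesis
      using D_op_deviation [OF \<open>c > 0\<close> that(1) _ that(2,3) cont that(4)] assms(2) by metis
  qed
  have small: "\<forall>\<^sub>F n in sequentially. \<forall>x\<ge>0.
      \<bar>D_op n c (\<beta> n) f x - f x\<bar> / (1 + x\<^sup>2) powr (1 + lam) \<le> e" if "e > 0" for e
  proof -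
    \<comment> \<open>The cut-off \<open>A\<close> is fixed before \<open>n\<close>: the tail bound
      below is \<open>5 M (1 + x\<^sup>2)\<close> before division by the weight.\<close>
    have "((\<lambda>A. (1 + A\<^sup>2) powr (- lam)) \<longlongrightarrow> 0) at_top"
      using \<open>lam > 0\<close>
      by (intro tendsto_neg_powr filterlim_tendsto_add_at_top [OF tendsto_const] filterlim_pow_at_top filterlim_ident) auto
    then have "((\<lambda>A. 5 * M * (1 + A\<^sup>2) powr (- lam)) \<longlongrightarrow> 0) at_top"
      by (rule tendsto_mult_right_zero)
    then have "\<forall>\<^sub>F A in at_top. 5 * M * (1 + A\<^sup>2) powr (- lam) < e"
      using \<open>e > 0\<close> by (rule order_tendstoD)
    then have "\<forall>\<^sub>F A in at_top. A \<ge> 0 \<and> 5 * M * (1 + A\<^sup>2) powr (- lam) < e"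
      using eventually_ge_at_top [of 0] by eventually_elim auto
    then obtain A where A: "A \<ge> 0" "5 * M * (1 + A\<^sup>2) powr (- lam) < e"
      using eventually_happens' [OF trivial_limit_at_top_linorder] by blast
    obtain K where K: "K \<ge> 0"
      "\<And>x t. 0 \<le> x \<Longrightarrow> x \<le> A \<Longrightarrow> 0 \<le> t \<Longrightarrow> \<bar>f t - f x\<bar> \<le> e/2 + K * (t - x)\<^sup>2"
      using deviation_le_quadratic [OF cont M A(1), of "e/2"] \<open>e > 0\<close> by auto
    \<comment> \<open>This dominates \<open>K\<close> times the second central moment for all
      \<open>x\<close> in \<open>[0, A]\<close>.\<close>
    have "(\<lambda>n. K * (A\<^sup>2 * \<bar>1 - 2 * r1 n + r2 n\<bar> + A * \<bar>s n\<bar>)) \<longlonglongrightarrow> K * (A\<^sup>2 * \<bar>1 - 2 * 1 + 1\<bar> + A * \<bar>0\<bar>)"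
      by (intro tendsto_intros lims)
    then have "\<forall>\<^sub>F n in sequentially. K * (A\<^sup>2 * \<bar>1 - 2 * r1 n + r2 n\<bar> + A * \<bar>s n\<bar>) < e/2"
      using \<open>e > 0\<close> by (intro order_tendstoD(2)) auto
    moreover have "\<forall>\<^sub>F n in sequentially. r2 n < 2" "\<forall>\<^sub>F n in sequentially. s n < 1"
      "\<forall>\<^sub>F n in sequentially. \<beta> n < 1/16"
      using order_tendstoD(2) [OF lims(2)] order_tendstoD(2) [OF lims(3)] order_tendstoD(2) [OF \<open>\<beta> \<longlonglongrightarrow> 0\<close>, of "1/16"] by auto
    moreover have "\<forall>\<^sub>F n in sequentially. real n > 3 * c"
      using filterlim_real_sequentially by (simp add: filterlim_at_top_dense)
    ultimately show ?thesis
    proof eventually_elim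
      case (elim n)
      show ?case
      proof (intro allI impI)
        fix x :: real assume x: "x \<ge> 0"
        have p1: "(1 + x\<^sup>2) powr (1 + lam) = (1 + x\<^sup>2) * (1 + x\<^sup>2) powr lam"
          by (simp add: powr_add add_pos_nonneg)
        show "\<bar>D_op n c (\<beta> n) f x - f x\<bar> / (1 + x\<^sup>2) powr (1 + lam) \<le> e"
        proof (cases "x \<le> A")
          case True
          \<comment> \<open>With \<open>x\<close> fixed, \<open>K (t - x)\<^sup>2\<close> is
            expanded in powers of \<open>t\<close>; the coefficients in \<open>dev\<close> may
            depend on \<open>x\<close> and be negative.\<close>
          have "\<bar>D_op n c (\<beta> n) f x - f x\<bar>
              \<le> (e/2 + K * x\<^sup>2) + (- 2 * K * x) * (r1 n * x) + K * (r2 n * x\<^sup>2 + s n * x)"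
          proof (rule dev)
            show "\<bar>f t - f x\<bar> \<le> (e/2 + K * x\<^sup>2) + (- 2 * K * x) * t + K * t\<^sup>2" if "t \<ge> 0" for t
              using K(2) [OF x True that] by (simp add: power2_eq_square algebra_simps)
          qed (use elim x in auto)
          also have "\<dots> = e/2 + K * (x\<^sup>2 * (1 - 2 * r1 n + r2 n) + x * s n)"
            by (simp add: power2_eq_square algebra_simps)
          also have "\<dots> \<le> e/2 + K * (A\<^sup>2 * \<bar>1 - 2 * r1 n + r2 n\<bar> + A * \<bar>s n\<bar>)"
            using x True K(1) A(1) by (intro add_left_mono mult_left_mono add_mono mult_mono' order_trans
                [OF mult_left_mono [OF abs_ge_self] mult_right_mono] power_mono) auto
          also have "\<dots> \<le> e" using elim by simp
          finally have "\<bar>D_op n c (\<beta> n) f x - f x\<bar> \<le> e * 1" by simp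
          also have "\<dots> \<le> e * (1 + x\<^sup>2) powr (1 + lam)"
            using \<open>e > 0\<close> \<open>lam > 0\<close> by (intro mult_left_mono ge_one_powr_ge_zero) auto
          finally show ?thesis using \<open>e > 0\<close> by (simp add: divide_le_eq)
        next
          case False
          \<comment> \<open>In the tail \<open>f x\<close> is not compared with nearby values:
            taking \<open>b = 0\<close> bounds the operator by the growth of \<open>f\<close> alone,
            and \<open>r2 n < 2\<close>, \<open>s n < 1\<close> suffice.\<close>
          have "\<bar>D_op n c (\<beta> n) f x - 0\<bar> \<le> M + 0 * (r1 n * x) + M * (r2 n * x\<^sup>2 + s n * x)"
            using elim x M by (intro dev) (auto simp: algebra_simps)
          also have "\<dots> \<le> M + 0 * (r1 n * x) + M * (2 * x\<^sup>2 + 1 * x)"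
            using elim x M0 by (intro add_left_mono mult_left_mono add_mono mult_right_mono) auto
          finally have "\<bar>D_op n c (\<beta> n) f x - f x\<bar> \<le> M * (1 + (2 * x\<^sup>2 + x)) + M * (1 + x\<^sup>2)"
            using M [OF x] by (simp add: algebra_simps)
          also have "\<dots> = M * (2 + 3 * x\<^sup>2 + x)" by (simp add: algebra_simps)
          also have "\<dots> \<le> M * (5 * (1 + x\<^sup>2))"
          proof (intro mult_left_mono M0)
            have "0 \<le> (x - 1)\<^sup>2" by simp
            then show "2 + 3 * x\<^sup>2 + x \<le> 5 * (1 + x\<^sup>2)" using x by (simp add: power2_eq_square algebra_simps)
          qed
          finally have "\<bar>D_op n c (\<beta> n) f x - f x\<bar> / (1 + x\<^sup>2) powr (1 + lam)
              \<le> M * (5 * (1 + x\<^sup>2)) / (1 + x\<^sup>2) powr (1 + lam)"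
            by (intro divide_right_mono) auto
          also have "\<dots> = 5 * M * (1 + x\<^sup>2) powr (- lam)"
          proof -
            have "1 + x\<^sup>2 \<noteq> 0" by (metis add_pos_nonneg less_irrefl zero_le_power2 zero_less_one)
            from nonzero_mult_divide_mult_cancel_left [OF this, of "5 * M"]
            have "M * (5 * (1 + x\<^sup>2)) / ((1 + x\<^sup>2) * P) = 5 * M / P" for P
              by (simp only: mult_ac)
            then show ?thesis by (simp only: p1 powr_minus_divide times_divide_eq_right mult_1_right)
          qed
          also have "\<dots> \<le> 5 * M * (1 + A\<^sup>2) powr (- lam)"
          proof (intro mult_left_mono)
            have "A\<^sup>2 \<le> x\<^sup>2" using False A by (intro power_mono) auto
            then show "(1 + x\<^sup>2) powr (- lam) \<le> (1 + A\<^sup>2) powr (- lam)"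
              using \<open>lam > 0\<close> by (intro powr_mono2') (auto simp: add_pos_nonneg)
          qed (use M0 in simp)
          finally show ?thesis using A(2) by simp
        qed
      qed
    qed
  qed
  show ?thesis
    by (rule SUP_ereal_tendsto_0) (use small in \<open>simp_all add: Ball_def\<close>)
qed

end
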